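(* Let $p$ be an odd prime and let $t\in D_p$. Then modulo $p$: \begin{align*} \sum_{k=0}^{\lfloor p/4\rfloor}C_{2k}t^k&\equiv 2(-1)^{\frac{p-1}{2}}w_{\lfloor p/4\rfloor}(1-32t),\\ \sum_{k=(p-1)/2}^{\lfloor3p/4\rfloor}C_{2k}t^k&\equiv \frac{(-1)^{\frac{p+1}{2}}}{2}\Bigl(w_{\lfloor 3p/4\rfloor}(1-32t)+w_{\lfloor p/4\rfloor}(1-32t)\Bigr),\\ \sum_{k=0}^{\lfloor p/4\rfloor}\binom{4k}{2k} t^k&\equiv \left(\frac{-2}{p}\right) w_{\lfloor p/4\rfloor}(32t-1),\\ \sum_{k=(p+1)/2}^{\lfloor3p/4\rfloor}\binom{4k}{2k} t^k&\equiv \frac{1}{4}\left(\frac{-2}{p}\right)\Bigl(w_{\lfloor 3p/4\rfloor}(32t-1)-w_{\lfloor p/4\rfloor}(32t-1)\Bigr). \end{align*}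
   Context: $C_n=\frac{1}{n+1}\binom{2n}{n}$ are the Catalan numbers. The polynomials $w_n(x)$ are defined by $w_0(x)=1$, $w_1(x)=1+2x$, $w_{n+1}(x)=2xw_n(x)-w_{n-1}(x)$. $D_p$ is the set of rationals whose denominator is not divisible by $p$; congruences between elements of $D_p$ are in the usual sense. $\left(\frac{\cdot}{p}\right)$ is the Legendre symbol. *)

theory Defs
  imports "HOL-Number_Theory.Number_Theory" "HOL-Computational_Algebra.Polynomial"
begin

definition catalan :: "nat \<Rightarrow> rat" where
  "catalan n = 1 / of_nat (n + 1) * of_nat ((2 * n) choose n)"

fun w :: "nat \<Rightarrow> rat poly" where
  "w 0 = 1"
| "w (Suc 0) = [:1, 2:]"
| "w (Suc (Suc n)) = [:0, 2:] * w (Suc n) - w n"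

text \<open>The function \<^const>\<open>quotient_of\<close> returns numerator and denominator in lowest terms,
  with positive denominator.\<close>

definition D :: "nat \<Rightarrow> rat set" where
  "D p = {x. \<not> int p dvd snd (quotient_of x)}"

definition rat_cong :: "rat \<Rightarrow> rat \<Rightarrow> nat \<Rightarrow> bool"  (\<open>(\<open>indent=1\<close>[_ \<equiv>\<^sub>D _] '(mod _'))\<close>) where
  "[x \<equiv>\<^sub>D y] (mod p) \<longleftrightarrow>
     x \<in> D p \<and> y \<in> D p \<and> (\<exists>z \<in> D p. x - y = of_nat p * z)"

end

theory Submission
  imports Defs
begin

text \<open>
  Let \<open>P\<^sub>k(y)\<close> (below \<open>central_fact y k\<close>) be the product of \<open>4 ((4i + 2)\<^sup>2 - y\<^sup>2)\<close> over \<open>i < k\<close>. Then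
  \<open>P\<^sub>k(1) = (4k)! / (2k)!\<close> equals both \<open>(2k)!\<close> times \<open>(4k choose 2k)\<close> and \<open>(2k + 1)!\<close> times
  \<open>C\<^sub>2\<^sub>k\<close>, whereas \<open>P\<^sub>k(4n + 2) = (-64)^k (n + k)! / (n - k)!\<close> equals \<open>(2k)!\<close> times the
  coefficient of \<open>t^k\<close> in \<open>(-1)^n w\<^sub>n(32t - 1)\<close>, and \<open>(2n + 1) P\<^sub>k(4n + 2)\<close> equals \<open>(2k + 1)!\<close> times
  that in \<open>w\<^sub>n(1 - 32t)\<close>. So everything is compared coefficient by coefficient.

  Put \<open>s = (-1)^((p - 1) / 2)\<close>. For \<open>n = \<lfloor>p/4\<rfloor>\<close> and \<open>n = \<lfloor>3p/4\<rfloor>\<close> the number \<open>4n + 2\<close> is \<open>p + s\<close>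
  and \<open>3p - s\<close>, so \<open>P\<^sub>k(4n + 2) \<equiv> P\<^sub>k(1)\<close> modulo \<open>p\<close>. For \<open>k > \<lfloor>p/4\<rfloor>\<close> the factor at \<open>i = \<lfloor>p/4\<rfloor>\<close>
  is divisible by \<open>p\<close> and makes \<open>P\<^sub>k(3p - s) \<equiv> 4 P\<^sub>k(1)\<close> modulo \<open>p\<^sup>2\<close>, which pays for the single
  factor \<open>p\<close> of the factorials that have to be cancelled.
\<close>

section \<open>Congruences between $p$-integral rationals\<close>

lemma of_int_divide_in_D:
  assumes "\<not> int p dvd b"
  shows "of_int a / of_int b \<in> D p"
proof -
  obtain m n where mn: "quotient_of (of_int a / of_int b) = (m, n)" by force
  have "b \<noteq> 0" "n \<noteq> 0" using assms quotient_of_denom_pos[OF mn] by auto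
  then have "(of_int (m * b) :: rat) = of_int (a * n)"
    using quotient_of_div[OF mn] by (simp add: field_simps)
  then have "n dvd m * b" by (simp only: of_int_eq_iff dvd_triv_right)
  then have "n dvd b"
    using quotient_of_coprime[OF mn] by (simp add: coprime_dvd_mult_right_iff coprime_commute)
  then show ?thesis using assms mn by (auto simp: D_def dest: dvd_trans)
qed

lemma in_D_E:
  assumes "x \<in> D p"
  obtains a b where "\<not> int p dvd b" "b \<noteq> 0" "x = of_int a / of_int b"
proof
  show "\<not> int p dvd snd (quotient_of x)" using assms by (simp add: D_def)
  then show "snd (quotient_of x) \<noteq> 0" by auto
  show "x = of_int (fst (quotient_of x)) / of_int (snd (quotient_of x))"
    by (rule quotient_of_div) simp
qed

lemma of_int_in_D: "prime p \<Longrightarrow> of_int a \<in> D p"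
  using of_int_divide_in_D[of p 1 a] by (auto simp: prime_nat_iff)

lemma add_in_D:
  assumes "prime p" "x \<in> D p" "y \<in> D p"
  shows "x + y \<in> D p"
proof -
  obtain a b c d where "\<not> int p dvd b" "b \<noteq> 0" "x = of_int a / of_int b"
    "\<not> int p dvd d" "d \<noteq> 0" "y = of_int c / of_int d"
    using assms(2,3) by (elim in_D_E)
  then have "\<not> int p dvd b * d" "x + y = of_int (a * d + c * b) / of_int (b * d)"
    using assms(1) by (auto simp: prime_dvd_mult_iff field_simps)
  then show ?thesis by (metis of_int_divide_in_D)
qed

lemma mult_in_D:
  assumes "prime p" "x \<in> D p" "y \<in> D p"
  shows "x * y \<in> D p"
proof -
  obtain a b c d where "\<not> int p dvd b" "x = of_int a / of_int b"
    "\<not> int p dvd d" "y = of_int c / of_int d"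
    using assms(2,3) by (elim in_D_E)
  then have "\<not> int p dvd b * d" "x * y = of_int (a * c) / of_int (b * d)"
    using assms(1) by (auto simp: prime_dvd_mult_iff)
  then show ?thesis by (metis of_int_divide_in_D)
qed

lemma power_in_D: "prime p \<Longrightarrow> x \<in> D p \<Longrightarrow> x ^ n \<in> D p"
  using of_int_in_D[of p 1] by (induction n) (auto intro: mult_in_D)

lemma rat_cong_add:
  assumes "prime p" "[x \<equiv>\<^sub>D y] (mod p)" "[x' \<equiv>\<^sub>D y'] (mod p)"
  shows "[x + x' \<equiv>\<^sub>D y + y'] (mod p)"
proof -
  obtain z z' where "z \<in> D p" "x - y = of_nat p * z" "z' \<in> D p" "x' - y' = of_nat p * z'"
    using assms unfolding rat_cong_def by blast
  then have "x + x' - (y + y') = of_nat p * (z + z')" "z + z' \<in> D p"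
    by (simp_all add: algebra_simps add_in_D assms(1))
  then show ?thesis using assms unfolding rat_cong_def by (meson add_in_D)
qed

lemma rat_cong_mult_right:
  assumes "prime p" "[x \<equiv>\<^sub>D y] (mod p)" "c \<in> D p"
  shows "[x * c \<equiv>\<^sub>D y * c] (mod p)"
proof -
  obtain z where "z \<in> D p" "x - y = of_nat p * z"
    using assms unfolding rat_cong_def by blast
  then have "x * c - y * c = of_nat p * (z * c)" "z * c \<in> D p"
    by (simp_all add: mult_in_D assms flip: left_diff_distrib mult.assoc)
  then show ?thesis using assms unfolding rat_cong_def by (meson mult_in_D)
qed

lemma rat_cong_sum:
  assumes "prime p" "\<And>k. k \<in> S \<Longrightarrow> [f k \<equiv>\<^sub>D g k] (mod p)"
  shows "[sum f S \<equiv>\<^sub>D sum g S] (mod p)"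
proof -
  have "[0 \<equiv>\<^sub>D 0] (mod p)"
    using of_int_in_D[OF assms(1), of 0] by (auto simp: rat_cong_def)
  then show ?thesis
    using assms(2)
    by (induction S rule: infinite_finite_induct) (simp_all add: rat_cong_add assms(1))
qed

text \<open>
  In \<open>[a = b] ( mod m)\<close> the space is significant: \<open>(mod\<close> without it is a token of the notation for
  \<^const>\<open>rat_cong\<close>.
\<close>

lemma rat_cong_of_int_divide:
  assumes "[a = b] ( mod int p)" "\<not> int p dvd d"
  shows "[of_int a / of_int d \<equiv>\<^sub>D of_int b / of_int d] (mod p)"
proof -
  obtain e where "a - b = int p * e"
    using assms(1) by (auto simp: cong_iff_dvd_diff)
  then have "of_int a / of_int d - of_int b / of_int d = (of_nat p * (of_int e / of_int d) :: rat)"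
    by (metis diff_divide_distrib of_int_diff of_int_mult of_int_of_nat_eq times_divide_eq_right)
  then show ?thesis unfolding rat_cong_def using of_int_divide_in_D[OF assms(2)] by blast
qed

lemma rat_cong_sum_powers_poly:
  assumes "prime p" "t \<in> D p" "\<not> int p dvd d" "finite S"
    and cong: "\<And>k. [(if k \<in> S then d * a k else 0) = b k] ( mod int p)"
    and coeff: "\<And>k. of_int d * coeff P k = of_int (b k)"
  shows "[(\<Sum>k\<in>S. of_int (a k) * t ^ k) \<equiv>\<^sub>D poly P t] (mod p)"
proof -
  obtain M where "S \<subseteq> {..M}" using assms(4) finite_nat_iff_bounded_le by blast
  define N where "N = max M (degree P)"
  have "d \<noteq> 0" using assms(3) by auto
  have sum_eq: "(\<Sum>k\<in>S. of_int (a k) * t ^ k) =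
      (\<Sum>k\<le>N. of_int (if k \<in> S then d * a k else 0) / of_int d * t ^ k)"
    using \<open>S \<subseteq> {..M}\<close> \<open>d \<noteq> 0\<close> by (intro sum.mono_neutral_cong_left) (auto simp: N_def)
  have "poly P t = (\<Sum>k\<le>N. coeff P k * t ^ k)"
    using arg_cong[OF poly_as_sum_of_monoms'[of P N], of "\<lambda>Q. poly Q t"]
    by (simp add: N_def poly_sum poly_monom)
  then have poly_eq: "poly P t = (\<Sum>k\<le>N. of_int (b k) / of_int d * t ^ k)"
    using \<open>d \<noteq> 0\<close> by (simp flip: coeff)
  show ?thesis
    unfolding sum_eq poly_eq
    by (intro rat_cong_sum rat_cong_mult_right rat_cong_of_int_divide power_in_D cong assms(1-3))
qed

section \<open>Prime powers and factorials\<close>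

lemma odd_prime_gt_2_nat: "prime p \<Longrightarrow> odd p \<Longrightarrow> 2 < (p :: nat)"
  using prime_gt_1_nat[of p] by (cases "p = 2") auto

lemma multiplicity_fact:
  assumes "prime p" "n < p\<^sup>2"
  shows "multiplicity p (fact n :: nat) = n div p"
  using assms(2)
proof (induction n)
  case (Suc n)
  have "multiplicity p (Suc n) = (if p dvd Suc n then 1 else 0)"
  proof (cases "p dvd Suc n")
    case True
    then obtain l where l: "Suc n = p * l" by blast
    have "0 < l" using l by (intro gr0I) simp
    moreover have "l < p" using Suc.prems unfolding l power2_eq_square by simp
    ultimately show ?thesis
      using l assms(1)
      by (simp add: multiplicity_times_same nat_dvd_not_less not_dvd_imp_multiplicity_0)
  qed (simp add: not_dvd_imp_multiplicity_0)
  moreover have "multiplicity p (fact (Suc n) :: nat) =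
      multiplicity p (Suc n) + multiplicity p (fact n :: nat)"
    unfolding fact_Suc of_nat_id using assms(1) by (intro prime_elem_multiplicity_mult_distrib) auto
  ultimately show ?case
    using Suc by (simp add: div_Suc dvd_eq_mod_eq_0 del: fact_Suc)
qed simp

lemma prime_power_not_dvd_fact:
  assumes "prime p" "n < e * p" "e \<le> p"
  shows "\<not> int p ^ e dvd fact n"
proof -
  have "n < p\<^sup>2"
    unfolding power2_eq_square using assms(2,3) by (meson less_le_trans mult_le_mono1)
  then have "\<not> p ^ e dvd fact n"
    using assms multiplicity_fact[of p n] less_mult_imp_div_less[OF assms(2)]
    by (subst power_dvd_iff_le_multiplicity) auto
  then show ?thesis by (metis of_nat_dvd_iff of_nat_fact of_nat_power)
qed

lemma cong_mult_lcancel_prime_power: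
  fixes p :: int
  assumes "prime p" "[d * x = d * y] ( mod p ^ e)" "\<not> p ^ e dvd d"
  shows "[x = y] ( mod p)"
  using assms
    prime_elem_power_dvd_cases[OF _ _ prime_imp_prime_elem[OF assms(1)], of e d "x - y" e 1]
  by (simp add: cong_iff_dvd_diff right_diff_distrib)

section \<open>Catalan numbers and the product $P_k$\<close>

lemma int_Suc_times_binomial:
  "int (Suc k) * int (Suc n choose Suc k) = int (Suc n) * int (n choose k)"
  by (metis Suc_times_binomial of_nat_mult)

lemma int_Suc_times_binomial_Suc:
  "int (Suc k) * int (n choose Suc k) = (int n - int k) * int (n choose k)"
proof (cases "k \<le> n")
  case True
  have "Suc k * (n choose Suc k) = (n - k) * (n choose k)"
    by (simp only: binomial_absorption binomial_absorb_comp)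
  then show ?thesis using True by (metis of_nat_diff of_nat_mult)
qed (simp add: binomial_eq_0)

definition catalan_int :: "nat \<Rightarrow> int" where
  "catalan_int n = int ((2 * n) choose n) - int ((2 * n) choose Suc n)"

lemma Suc_times_catalan_int: "int (Suc n) * catalan_int n = int ((2 * n) choose n)"
proof -
  have "int (Suc n) * catalan_int n =
      int (Suc n) * int ((2 * n) choose n) - int n * int ((2 * n) choose n)"
    unfolding catalan_int_def right_diff_distrib int_Suc_times_binomial_Suc by simp
  then show ?thesis by (simp add: algebra_simps)
qed

lemma of_int_catalan_int: "of_int (catalan_int n) = catalan n"
proof -
  have "of_int (int (Suc n) * catalan_int n) = (of_nat ((2 * n) choose n) :: rat)"
    by (simp only: Suc_times_catalan_int of_int_of_nat_eq)
  then show ?thesis by (simp add: catalan_def field_simps)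
qed

definition central_fact :: "int \<Rightarrow> nat \<Rightarrow> int" where
  "central_fact y k = (\<Prod>i<k. 4 * ((4 * int i + 2)\<^sup>2 - y\<^sup>2))"

lemma central_fact_0 [simp]: "central_fact y 0 = 1"
  by (simp add: central_fact_def)

lemma central_fact_Suc:
  "central_fact y (Suc k) = central_fact y k * (4 * ((4 * int k + 2)\<^sup>2 - y\<^sup>2))"
  by (simp add: central_fact_def)

lemma central_fact_cong:
  "[y\<^sup>2 = z\<^sup>2] ( mod m) \<Longrightarrow> [central_fact y k = central_fact z k] ( mod m)"
  unfolding central_fact_def by (intro cong_prod cong_scalar_left cong_diff cong_refl)

lemma central_fact_cong_1:
  assumes "[y = e] ( mod m)" "e\<^sup>2 = 1"
  shows "[central_fact y k = central_fact 1 k] ( mod m)"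
  using central_fact_cong[of y 1 m] cong_pow[OF assms(1), of 2] assms(2) by simp

lemma central_fact_cong_square:
  assumes "e\<^sup>2 = 1" "4 * int i + 2 = m + e" "i < k"
  shows "[central_fact (3 * m - e) k = 4 * central_fact 1 k] ( mod m\<^sup>2)"
proof -
  define factor where "factor y j = 4 * ((4 * int j + 2)\<^sup>2 - y\<^sup>2)" for y j
  define rest where "rest y = (\<Prod>j\<in>{..<k} - {i}. factor y j)" for y
  have split: "central_fact y k = factor y i * rest y" for y
    unfolding central_fact_def factor_def[symmetric] rest_def
    using assms(3) by (intro prod.remove) auto
  have "factor (3 * m - e) i - 4 * factor 1 i = m\<^sup>2 * (- 48)"
    unfolding factor_def assms(2) using assms(1) by (simp add: power2_eq_square algebra_simps)
  then have factor: "[factor (3 * m - e) i = 4 * factor 1 i] ( mod m\<^sup>2)"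
    by (simp add: cong_iff_dvd_diff)
  have "[(3 * m - e)\<^sup>2 = (- e)\<^sup>2] ( mod m)"
    by (intro cong_pow) (simp add: cong_iff_dvd_diff)
  then have "[rest (3 * m - e) = rest 1] ( mod m)"
    unfolding rest_def factor_def
    by (intro cong_prod cong_scalar_left cong_diff cong_refl) (simp add: assms(1))
  moreover have "4 * factor 1 i = m * (16 * (m + 2 * e))"
    unfolding factor_def assms(2) using assms(1) by (simp add: power2_eq_square algebra_simps)
  ultimately have "m\<^sup>2 dvd 4 * factor 1 i * (rest (3 * m - e) - rest 1)"
    unfolding power2_eq_square by (intro mult_dvd_mono) (auto simp: cong_iff_dvd_diff)
  then have "[4 * factor 1 i * rest (3 * m - e) = 4 * factor 1 i * rest 1] ( mod m\<^sup>2)"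
    by (simp add: cong_iff_dvd_diff right_diff_distrib)
  with cong_scalar_right[OF factor] show ?thesis
    unfolding split mult.assoc[symmetric] by (rule cong_trans)
qed

lemma central_fact_1_times_fact: "central_fact 1 k * fact (2 * k) = fact (4 * k)"
proof (induction k)
  case (Suc k)
  have "2 * Suc k = Suc (Suc (2 * k))" "4 * Suc k = Suc (Suc (Suc (Suc (4 * k))))" by simp_all
  then show ?case
    unfolding central_fact_Suc
    by (simp only: fact_Suc flip: Suc.IH) (simp add: power2_eq_square algebra_simps)
qed simp

lemma fact_times_central_binomial: "fact (2 * k) * int ((4 * k) choose (2 * k)) = central_fact 1 k"
proof -
  have "fact (2 * k) * fact (2 * k) * ((4 * k) choose (2 * k)) = (fact (4 * k) :: nat)"
    using binomial_fact_lemma[of "2 * k" "4 * k"] by simp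
  then have "fact (2 * k) * fact (2 * k) * int ((4 * k) choose (2 * k)) = fact (4 * k)"
    by (metis of_nat_fact of_nat_mult)
  then show ?thesis by (simp flip: central_fact_1_times_fact)
qed

lemma fact_times_catalan_int: "fact (2 * k + 1) * catalan_int (2 * k) = central_fact 1 k"
proof -
  have "fact (2 * k + 1) * catalan_int (2 * k) =
      fact (2 * k) * (int (Suc (2 * k)) * catalan_int (2 * k))"
    by (simp add: mult_ac)
  also have "\<dots> = central_fact 1 k"
    unfolding Suc_times_catalan_int by (simp flip: fact_times_central_binomial)
  finally show ?thesis .
qed

section \<open>Coefficients of the Chebyshev polynomials\<close>

text \<open>
  The polynomials \<open>(-1)^n w\<^sub>n(-x)\<close> and \<open>w\<^sub>n(x)\<close> are the Chebyshev polynomials of the third and fourth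
  kind; their coefficients are taken at \<open>x = 1 - 32t\<close>.
\<close>

definition chebyshev3_coeff :: "nat \<Rightarrow> nat \<Rightarrow> int" where
  "chebyshev3_coeff n k = (-64) ^ k * int ((n + k) choose (2 * k))"

definition chebyshev4_coeff :: "nat \<Rightarrow> nat \<Rightarrow> int" where
  "chebyshev4_coeff n k =
     (-64) ^ k * (int ((n + k) choose (2 * k + 1)) + int ((n + k + 1) choose (2 * k + 1)))"

lemma chebyshev3_coeff_eq_0: "n < k \<Longrightarrow> chebyshev3_coeff n k = 0"
  by (simp add: chebyshev3_coeff_def binomial_eq_0)

lemma chebyshev4_coeff_eq_0: "n < k \<Longrightarrow> chebyshev4_coeff n k = 0"
  by (simp add: chebyshev4_coeff_def binomial_eq_0 del: binomial_Suc_Suc)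

lemma chebyshev_coeff_0:
  "chebyshev3_coeff n 0 = 1" "chebyshev4_coeff n 0 = 2 * int n + 1"
  by (simp_all add: chebyshev3_coeff_def chebyshev4_coeff_def)

lemma chebyshev_coeff_recurrence:
  "chebyshev3_coeff (Suc (Suc n)) (Suc k) =
     2 * chebyshev3_coeff (Suc n) (Suc k) - 64 * chebyshev3_coeff (Suc n) k -
     chebyshev3_coeff n (Suc k)"
  "chebyshev4_coeff (Suc (Suc n)) (Suc k) =
     2 * chebyshev4_coeff (Suc n) (Suc k) - 64 * chebyshev4_coeff (Suc n) k -
     chebyshev4_coeff n (Suc k)"
  by (simp_all add: chebyshev3_coeff_def chebyshev4_coeff_def algebra_simps)

lemma w_pcompose_Suc_Suc:
  "w (Suc (Suc n)) \<circ>\<^sub>p [:a, b:] = [:2 * a, 2 * b:] * (w (Suc n) \<circ>\<^sub>p [:a, b:]) - w n \<circ>\<^sub>p [:a, b:]"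
  by (simp add: pcompose_diff pcompose_mult pcompose_smult pcompose_pCons smult_add_right
      mult.commute)

lemma coeff_w_one_minus_32: "coeff (w n \<circ>\<^sub>p [:1, -32:]) k = of_int (chebyshev4_coeff n k)"
proof (induction n arbitrary: k rule: w.induct)
  case 1
  show ?case by (cases k) (simp_all add: chebyshev4_coeff_def pcompose_1 binomial_eq_0)
next
  case 2
  show ?case
    by (simp add: pcompose_pCons coeff_pCons chebyshev4_coeff_def binomial_eq_0 split: nat.split)
next
  case (3 n)
  show ?case
    by (cases k) (simp_all add: w_pcompose_Suc_Suc 3 chebyshev_coeff_0 chebyshev_coeff_recurrence
        algebra_simps del: w.simps coeff_pcompose_0)
qed

lemma coeff_w_32_minus_one: "coeff (w n \<circ>\<^sub>p [:-1, 32:]) k = (-1) ^ n * of_int (chebyshev3_coeff n k)"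
proof (induction n arbitrary: k rule: w.induct)
  case 1
  show ?case by (cases k) (simp_all add: chebyshev3_coeff_def pcompose_1 binomial_eq_0)
next
  case 2
  show ?case
    by (simp add: pcompose_pCons coeff_pCons chebyshev3_coeff_def binomial_eq_0 split: nat.split)
next
  case (3 n)
  show ?case
    by (cases k) (simp_all add: w_pcompose_Suc_Suc 3 chebyshev_coeff_0 chebyshev_coeff_recurrence
        algebra_simps del: w.simps coeff_pcompose_0)
qed

lemma fact_times_chebyshev3_coeff:
  "fact (2 * k) * chebyshev3_coeff n k = central_fact (4 * int n + 2) k"
proof (induction k)
  case (Suc k)
  have "fact (2 * Suc k) * int ((n + Suc k) choose (2 * Suc k)) = fact (2 * k) * int (Suc (2 * k)) *
      (int (Suc (Suc (2 * k))) * int (Suc (n + k) choose Suc (Suc (2 * k))))"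
    by (simp add: mult_ac del: binomial_Suc_Suc of_nat_Suc)
  also have "\<dots> = fact (2 * k) * int (Suc (n + k)) *
      (int (Suc (2 * k)) * int ((n + k) choose Suc (2 * k)))"
    unfolding int_Suc_times_binomial by (simp only: mult_ac)
  also have "\<dots> = fact (2 * k) * int (Suc (n + k)) * (int n - int k) * int ((n + k) choose (2 * k))"
    by (simp add: int_Suc_times_binomial_Suc del: of_nat_Suc)
  finally have absorb: "fact (2 * Suc k) * int ((n + Suc k) choose (2 * Suc k)) = \<dots>" .
  have "fact (2 * Suc k) * chebyshev3_coeff n (Suc k) =
      (-64) ^ Suc k * (fact (2 * Suc k) * int ((n + Suc k) choose (2 * Suc k)))"
    unfolding chebyshev3_coeff_def by (simp only: mult_ac)
  also have "\<dots> = fact (2 * k) * chebyshev3_coeff n k * (-64 * int (Suc (n + k)) * (int n - int k))"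
    unfolding absorb by (simp add: chebyshev3_coeff_def del: of_nat_Suc)
  finally show ?case
    unfolding central_fact_Suc Suc.IH by (simp add: power2_eq_square algebra_simps)
qed (simp add: chebyshev3_coeff_def)

lemma fact_times_chebyshev4_coeff:
  "fact (2 * k + 1) * chebyshev4_coeff n k = (2 * int n + 1) * central_fact (4 * int n + 2) k"
proof -
  have "int (Suc (2 * k)) * int ((n + k) choose Suc (2 * k)) =
      (int n - int k) * int ((n + k) choose (2 * k))"
    by (simp add: int_Suc_times_binomial_Suc del: of_nat_Suc)
  moreover have "int (Suc (2 * k)) * int (Suc (n + k) choose Suc (2 * k)) =
      int (Suc (n + k)) * int ((n + k) choose (2 * k))"
    by (rule int_Suc_times_binomial)
  ultimately have "int (Suc (2 * k)) *
      (int ((n + k) choose Suc (2 * k)) + int (Suc (n + k) choose Suc (2 * k))) =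
      (2 * int n + 1) * int ((n + k) choose (2 * k))"
    unfolding distrib_left by (simp add: algebra_simps)
  then show ?thesis
    by (simp add: chebyshev4_coeff_def chebyshev3_coeff_def del: binomial_Suc_Suc of_nat_Suc
        flip: fact_times_chebyshev3_coeff)
qed

lemma chebyshev3_coeff_cong_binomial:
  assumes "prime p" "\<not> int p ^ e dvd fact (2 * k)"
    and "[central_fact (4 * int n + 2) k = c * central_fact 1 k] ( mod int p ^ e)"
  shows "[chebyshev3_coeff n k = c * int ((4 * k) choose (2 * k))] ( mod int p)"
proof (rule cong_mult_lcancel_prime_power)
  show "[fact (2 * k) * chebyshev3_coeff n k =
      fact (2 * k) * (c * int ((4 * k) choose (2 * k)))] ( mod int p ^ e)"
    using assms(3)
    by (simp add: fact_times_chebyshev3_coeff mult.left_commute flip: fact_times_central_binomial)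
qed (use assms in simp_all)

lemma chebyshev4_coeff_cong_catalan:
  assumes "prime p" "\<not> int p ^ e dvd fact (2 * k + 1)"
    and "[central_fact (4 * int n + 2) k = c * central_fact 1 k] ( mod int p ^ e)"
    and "[4 * int n + 2 = u] ( mod int p)"
  shows "[2 * chebyshev4_coeff n k = u * (c * catalan_int (2 * k))] ( mod int p)"
proof -
  have "fact (2 * k + 1) * (2 * chebyshev4_coeff n k) =
      (4 * int n + 2) * central_fact (4 * int n + 2) k"
    using fact_times_chebyshev4_coeff[of k n] by (simp add: algebra_simps)
  moreover have "fact (2 * k + 1) * ((4 * int n + 2) * (c * catalan_int (2 * k))) =
      (4 * int n + 2) * (c * central_fact 1 k)"
    unfolding fact_times_catalan_int[symmetric] by (simp only: mult_ac)
  ultimately have "[fact (2 * k + 1) * (2 * chebyshev4_coeff n k) =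
      fact (2 * k + 1) * ((4 * int n + 2) * (c * catalan_int (2 * k)))] ( mod int p ^ e)"
    by (simp only: cong_scalar_left assms(3))
  then have "[2 * chebyshev4_coeff n k = (4 * int n + 2) * (c * catalan_int (2 * k))] ( mod int p)"
    by (rule cong_mult_lcancel_prime_power[rotated]) (use assms(1,2) in simp_all)
  then show ?thesis by (rule cong_trans) (intro cong_scalar_right assms(4))
qed

section \<open>The Legendre symbol of $-2$\<close>

lemma Legendre_cong: "[a = b] ( mod p) \<Longrightarrow> Legendre a p = Legendre b p"
  by (simp add: Legendre_def QuadRes_def cong_def)

lemma Legendre_minus_two:
  assumes "prime p" "odd p"
  shows "Legendre (-2) (int p) = (-1) ^ (p div 4)"
proof -
  have "2 < p" using assms by (rule odd_prime_gt_2_nat)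
  interpret GAUSS p "int p - 2"
    using assms \<open>2 < p\<close> by unfold_locales (auto simp: cong_0_iff dest: zdvd_imp_le)
  have residue: "x * (int p - 2) mod int p = int p - 2 * x" if "x \<in> A" for x
  proof -
    have "x * (int p - 2) mod int p = (int p - 2 * x + int p * (x - 1)) mod int p"
      by (simp add: algebra_simps)
    also have "\<dots> = (int p - 2 * x) mod int p" by (rule mod_mult_self2)
    also have "\<dots> = int p - 2 * x"
      using that p_eq2 by (intro mod_pos_pos_trivial) (auto simp: A_def)
    finally show ?thesis .
  qed
  have "C = (\<lambda>x. int p - 2 * x) ` A"
    unfolding C_def B_def image_image using residue by (rule image_cong[OF refl])
  then have "E = (\<lambda>x. int p - 2 * x) ` {x \<in> A. (int p - 1) div 2 < int p - 2 * x}"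
    by (auto simp: E_def)
  also have "{x \<in> A. (int p - 1) div 2 < int p - 2 * x} = {0<..int (p div 4)}"
    unfolding A_def using \<open>odd p\<close> by auto
  finally have "card E = p div 4" by (simp add: card_image inj_on_def)
  moreover have "Legendre (-2) (int p) = Legendre (int p - 2) (int p)"
    by (intro Legendre_cong) (simp add: cong_iff_dvd_diff)
  ultimately show ?thesis using gauss_lemma by simp
qed

section \<open>The four congruences\<close>

locale odd_prime =
  fixes p :: nat
  assumes prime_p: "prime p" and odd_p: "odd p"
begin

abbreviation "q \<equiv> p div 4"
abbreviation "r \<equiv> 3 * p div 4"
abbreviation "m \<equiv> (p - 1) div 2"

definition s :: int where "s = (-1) ^ m"

lemma gt_2: "2 < p"
  using prime_p odd_p by (rule odd_prime_gt_2_nat)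

lemma p_eq_double_m: "p = 2 * m + 1"
  using odd_p by simp

lemma q_less_m: "q < m"
  using odd_p gt_2 by presburger

lemma mod_4_cases:
  obtains n where "p = 4 * n + 1" "q = n" "r = 3 * n" "m = 2 * n"
    | n where "p = 4 * n + 3" "q = n" "r = 3 * n + 2" "m = 2 * n + 1"
proof -
  have "\<exists>n. p = 4 * n + 1 \<or> p = 4 * n + 3" using odd_p by presburger
  then show ?thesis using that by auto
qed

lemma r_plus_q: "r + q + 1 = p"
  by (cases rule: mod_4_cases) linarith+

lemma double_r_less: "2 * r + 1 < 2 * p"
  using gt_2 by linarith

lemma s_square: "s\<^sup>2 = 1"
  by (simp add: s_def flip: power_mult)

lemma s_times_s: "s * (s * x) = x"
  using s_square by (simp add: power2_eq_square flip: mult.assoc)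

lemma four_q_plus_2: "4 * int q + 2 = int p + s"
proof (cases rule: mod_4_cases)
  case (1 n)
  then have "s = 1" unfolding s_def by simp
  then show ?thesis using 1 by linarith
next
  case (2 n)
  then have "s = -1" unfolding s_def by simp
  then show ?thesis using 2 by linarith
qed

lemma four_r_plus_2: "4 * int r + 2 = 3 * int p - s"
  using four_q_plus_2 r_plus_q by linarith

lemma four_q_plus_2_cong: "[4 * int q + 2 = s] ( mod int p)"
  unfolding four_q_plus_2 by (simp add: cong_iff_dvd_diff)

lemma four_r_plus_2_cong: "[4 * int r + 2 = - s] ( mod int p)"
  unfolding four_r_plus_2 by (simp add: cong_iff_dvd_diff)

lemma central_fact_r_cong_square:
  "q < k \<Longrightarrow> [central_fact (4 * int r + 2) k = 4 * central_fact 1 k] ( mod (int p)\<^sup>2)"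
  unfolding four_r_plus_2 by (intro central_fact_cong_square[of _ q] s_square four_q_plus_2)

lemma not_dvd_fact: "n < p \<Longrightarrow> \<not> int p ^ 1 dvd fact n"
  using prime_p gt_2 by (intro prime_power_not_dvd_fact) auto

lemma square_not_dvd_fact: "n < 2 * p \<Longrightarrow> \<not> (int p)\<^sup>2 dvd fact n"
  using prime_p gt_2 by (intro prime_power_not_dvd_fact) auto

lemma chebyshev3_coeff_cong:
  assumes "[4 * int n + 2 = e] ( mod int p)" "e\<^sup>2 = 1" "2 * k < p"
  shows "[chebyshev3_coeff n k = int ((4 * k) choose (2 * k))] ( mod int p)"
  using chebyshev3_coeff_cong_binomial[OF prime_p not_dvd_fact[OF assms(3)], of n 1]
    central_fact_cong_1[OF assms(1,2)] by simp

lemma chebyshev4_coeff_cong: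
  assumes "[4 * int n + 2 = e] ( mod int p)" "e\<^sup>2 = 1" "2 * k + 1 < p"
  shows "[2 * chebyshev4_coeff n k = e * catalan_int (2 * k)] ( mod int p)"
  using chebyshev4_coeff_cong_catalan[OF prime_p not_dvd_fact[OF assms(3)] _ assms(1), of 1]
    central_fact_cong_1[OF assms(1,2)] by simp

lemma chebyshev3_coeff_q_cong:
  "2 * k < p \<Longrightarrow> [chebyshev3_coeff q k = int ((4 * k) choose (2 * k))] ( mod int p)"
  by (rule chebyshev3_coeff_cong[OF four_q_plus_2_cong s_square])

lemma chebyshev3_coeff_r_cong:
  "2 * k < p \<Longrightarrow> [chebyshev3_coeff r k = int ((4 * k) choose (2 * k))] ( mod int p)"
  using chebyshev3_coeff_cong[OF four_r_plus_2_cong] s_square by simp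

lemma chebyshev4_coeff_q_cong:
  "2 * k + 1 < p \<Longrightarrow> [2 * chebyshev4_coeff q k = s * catalan_int (2 * k)] ( mod int p)"
  by (rule chebyshev4_coeff_cong[OF four_q_plus_2_cong s_square])

lemma chebyshev4_coeff_r_cong:
  "2 * k + 1 < p \<Longrightarrow> [2 * chebyshev4_coeff r k = - s * catalan_int (2 * k)] ( mod int p)"
  using chebyshev4_coeff_cong[OF four_r_plus_2_cong] s_square by simp

lemma chebyshev3_coeff_r_cong_high:
  assumes "q < k" "k \<le> r"
  shows "[chebyshev3_coeff r k = 4 * int ((4 * k) choose (2 * k))] ( mod int p)"
proof (rule chebyshev3_coeff_cong_binomial[OF prime_p])
  show "\<not> (int p)\<^sup>2 dvd fact (2 * k)"
    using assms(2) double_r_less by (intro square_not_dvd_fact) simp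
qed (rule central_fact_r_cong_square[OF assms(1)])

lemma chebyshev4_coeff_r_cong_high:
  assumes "q < k" "k \<le> r"
  shows "[2 * chebyshev4_coeff r k = - s * (4 * catalan_int (2 * k))] ( mod int p)"
proof (rule chebyshev4_coeff_cong_catalan[OF prime_p])
  show "\<not> (int p)\<^sup>2 dvd fact (2 * k + 1)"
    using assms(2) double_r_less by (intro square_not_dvd_fact) simp
qed (rule central_fact_r_cong_square[OF assms(1)] four_r_plus_2_cong)+

lemma catalan_coeff_low_cong:
  "[(if k \<in> {0..q} then catalan_int (2 * k) else 0) = s * (2 * chebyshev4_coeff q k)] ( mod int p)"
proof (cases "k \<le> q")
  case True
  then have "2 * k + 1 < p" using q_less_m by linarith
  then have "[s * (2 * chebyshev4_coeff q k) = s * (s * catalan_int (2 * k))] ( mod int p)"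
    by (intro cong_scalar_left chebyshev4_coeff_q_cong)
  then show ?thesis using True by (simp add: s_times_s cong_sym)
qed (simp add: chebyshev4_coeff_eq_0)

lemma catalan_coeff_high_cong:
  "[(if k \<in> {m..r} then 4 * catalan_int (2 * k) else 0) =
     - s * (2 * chebyshev4_coeff r k + 2 * chebyshev4_coeff q k)] ( mod int p)"
proof -
  consider "k < m" | "m \<le> k" "k \<le> r" | "m \<le> k" "r < k" by linarith
  then show ?thesis
  proof cases
    case 1
    then have "2 * k + 1 < p" by linarith
    then have "[- s * (2 * chebyshev4_coeff r k + 2 * chebyshev4_coeff q k) =
        - s * (- s * catalan_int (2 * k) + s * catalan_int (2 * k))] ( mod int p)"
      by (intro cong_scalar_left cong_add chebyshev4_coeff_r_cong chebyshev4_coeff_q_cong)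
    then show ?thesis using 1 by (simp add: cong_sym)
  next
    case 2
    then have "q < k" using q_less_m by simp
    then have "[- s * (2 * chebyshev4_coeff r k) =
        - s * (- s * (4 * catalan_int (2 * k)))] ( mod int p)"
      using 2 by (intro cong_scalar_left chebyshev4_coeff_r_cong_high)
    then show ?thesis
      using 2 \<open>q < k\<close> by (simp add: chebyshev4_coeff_eq_0 s_times_s cong_sym)
  next
    case 3
    then show ?thesis using q_less_m by (simp add: chebyshev4_coeff_eq_0)
  qed
qed

lemma central_binomial_coeff_low_cong:
  "[(if k \<in> {0..q} then int ((4 * k) choose (2 * k)) else 0) = chebyshev3_coeff q k] ( mod int p)"
proof (cases "k \<le> q")
  case True
  then have "2 * k < p" using q_less_m by linarith
  then show ?thesis using True by (simp add: chebyshev3_coeff_q_cong cong_sym)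
qed (simp add: chebyshev3_coeff_eq_0)

lemma central_binomial_coeff_high_cong:
  "[(if k \<in> {Suc m..r} then 4 * int ((4 * k) choose (2 * k)) else 0) =
     chebyshev3_coeff r k - chebyshev3_coeff q k] ( mod int p)"
proof -
  consider "k \<le> m" | "m < k" "k \<le> r" | "m < k" "r < k" by linarith
  then show ?thesis
  proof cases
    case 1
    then have "2 * k < p" using p_eq_double_m by linarith
    then have "[chebyshev3_coeff r k - chebyshev3_coeff q k =
        int ((4 * k) choose (2 * k)) - int ((4 * k) choose (2 * k))] ( mod int p)"
      by (intro cong_diff chebyshev3_coeff_r_cong chebyshev3_coeff_q_cong)
    then show ?thesis using 1 by (simp add: cong_sym)
  next
    case 2
    then have "q < k" using q_less_m by simp
    then show ?thesis
      using 2 by (simp add: chebyshev3_coeff_eq_0 chebyshev3_coeff_r_cong_high cong_sym)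
  next
    case 3
    then show ?thesis using q_less_m by (simp add: chebyshev3_coeff_eq_0)
  qed
qed

lemma not_dvd_4: "\<not> int p dvd 4"
proof
  assume "int p dvd 4"
  then have "int p dvd 2" using prime_p prime_dvd_power[of "int p" 2 2] by simp
  then show False using gt_2 zdvd_imp_le by fastforce
qed

lemma sum_catalan_low:
  assumes "t \<in> D p"
  shows "[(\<Sum>k = 0..q. catalan (2 * k) * t ^ k) \<equiv>\<^sub>D 2 * (-1) ^ m * poly (w q) (1 - 32 * t)] (mod p)"
proof -
  define P where "P = smult (2 * (-1) ^ m) (w q \<circ>\<^sub>p [:1, -32:])"
  have "[(\<Sum>k = 0..q. of_int (catalan_int (2 * k)) * t ^ k) \<equiv>\<^sub>D poly P t] (mod p)"
  proof (rule rat_cong_sum_powers_poly[OF prime_p assms, where d = 1])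
    fix k
    show "[(if k \<in> {0..q} then 1 * catalan_int (2 * k) else 0) =
        s * (2 * chebyshev4_coeff q k)] ( mod int p)"
      unfolding mult_1 by (rule catalan_coeff_low_cong)
    show "of_int 1 * coeff P k = of_int (s * (2 * chebyshev4_coeff q k))"
      by (simp add: P_def coeff_w_one_minus_32 s_def)
  qed (use gt_2 in simp_all)
  then show ?thesis by (simp add: P_def poly_pcompose of_int_catalan_int mult.commute)
qed

lemma sum_catalan_high:
  assumes "t \<in> D p"
  shows "[(\<Sum>k = m..r. catalan (2 * k) * t ^ k) \<equiv>\<^sub>D
    (-1) ^ Suc m / 2 * (poly (w r) (1 - 32 * t) + poly (w q) (1 - 32 * t))] (mod p)"
proof -
  define P where "P = smult ((-1) ^ Suc m / 2) ((w r + w q) \<circ>\<^sub>p [:1, -32:])"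
  have "[(\<Sum>k = m..r. of_int (catalan_int (2 * k)) * t ^ k) \<equiv>\<^sub>D poly P t] (mod p)"
  proof (rule rat_cong_sum_powers_poly[OF prime_p assms not_dvd_4 _ catalan_coeff_high_cong])
    fix k
    show "of_int 4 * coeff P k =
        of_int (- s * (2 * chebyshev4_coeff r k + 2 * chebyshev4_coeff q k))"
      by (simp add: P_def pcompose_add coeff_w_one_minus_32 s_def algebra_simps)
  qed simp
  then show ?thesis by (simp add: P_def poly_pcompose of_int_catalan_int mult.commute)
qed

lemma sum_central_binomial_low:
  assumes "t \<in> D p"
  shows "[(\<Sum>k = 0..q. of_nat ((4 * k) choose (2 * k)) * t ^ k) \<equiv>\<^sub>D
    of_int (Legendre (-2) (int p)) * poly (w q) (32 * t - 1)] (mod p)"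
proof -
  define P where "P = smult ((-1) ^ q) (w q \<circ>\<^sub>p [:-1, 32:])"
  have "[(\<Sum>k = 0..q. of_int (int ((4 * k) choose (2 * k))) * t ^ k) \<equiv>\<^sub>D poly P t] (mod p)"
  proof (rule rat_cong_sum_powers_poly[OF prime_p assms, where d = 1])
    fix k
    show "[(if k \<in> {0..q} then 1 * int ((4 * k) choose (2 * k)) else 0) =
        chebyshev3_coeff q k] ( mod int p)"
      unfolding mult_1 by (rule central_binomial_coeff_low_cong)
    show "of_int 1 * coeff P k = of_int (chebyshev3_coeff q k)"
      by (simp add: P_def coeff_w_32_minus_one)
  qed (use gt_2 in simp_all)
  then show ?thesis
    by (simp add: P_def poly_pcompose mult.commute Legendre_minus_two prime_p odd_p)
qed

lemma sum_central_binomial_high: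
  assumes "t \<in> D p"
  shows "[(\<Sum>k = Suc m..r. of_nat ((4 * k) choose (2 * k)) * t ^ k) \<equiv>\<^sub>D
    1 / 4 * of_int (Legendre (-2) (int p)) *
      (poly (w r) (32 * t - 1) - poly (w q) (32 * t - 1))] (mod p)"
proof -
  define P where "P = smult ((-1) ^ q / 4) ((w r - w q) \<circ>\<^sub>p [:-1, 32:])"
  have "r + q = 2 * m" using r_plus_q p_eq_double_m by linarith
  then have "even r \<longleftrightarrow> even q" by (metis dvd_triv_left even_add)
  then have sign: "(-1 :: rat) ^ r = (-1) ^ q" by (simp add: minus_one_power_iff)
  have "[(\<Sum>k = Suc m..r. of_int (int ((4 * k) choose (2 * k))) * t ^ k) \<equiv>\<^sub>D poly P t] (mod p)"
  proof (rule rat_cong_sum_powers_poly[OF prime_p assms not_dvd_4 _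
        central_binomial_coeff_high_cong])
    fix k
    show "of_int 4 * coeff P k = of_int (chebyshev3_coeff r k - chebyshev3_coeff q k)"
      by (simp add: P_def pcompose_diff coeff_w_32_minus_one sign right_diff_distrib)
  qed simp
  then show ?thesis
    by (simp add: P_def poly_pcompose mult.commute Legendre_minus_two prime_p odd_p)
qed

end

theorem theorem3:
  fixes p :: nat and t :: rat
  assumes "prime p" and "odd p" and "t \<in> D p"
  shows "[(\<Sum>k = 0..p div 4. catalan (2 * k) * t ^ k) \<equiv>\<^sub>D
            2 * (-1) ^ ((p - 1) div 2) * poly (w (p div 4)) (1 - 32 * t)] (mod p) \<and>
         [(\<Sum>k = (p - 1) div 2..3 * p div 4. catalan (2 * k) * t ^ k) \<equiv>\<^sub>D
            (-1) ^ ((p + 1) div 2) / 2 *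
              (poly (w (3 * p div 4)) (1 - 32 * t) + poly (w (p div 4)) (1 - 32 * t))] (mod p) \<and>
         [(\<Sum>k = 0..p div 4. of_nat ((4 * k) choose (2 * k)) * t ^ k) \<equiv>\<^sub>D
            of_int (Legendre (-2) (int p)) * poly (w (p div 4)) (32 * t - 1)] (mod p) \<and>
         [(\<Sum>k = (p + 1) div 2..3 * p div 4. of_nat ((4 * k) choose (2 * k)) * t ^ k) \<equiv>\<^sub>D
            1 / 4 * of_int (Legendre (-2) (int p)) *
              (poly (w (3 * p div 4)) (32 * t - 1) - poly (w (p div 4)) (32 * t - 1))] (mod p)"
proof -
  interpret odd_prime p using assms(1,2) by unfold_locales
  have "(p + 1) div 2 = Suc ((p - 1) div 2)" using p_eq_double_m by linarith
  then show ?thesis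
    using sum_catalan_low[OF assms(3)] sum_catalan_high[OF assms(3)]
      sum_central_binomial_low[OF assms(3)] sum_central_binomial_high[OF assms(3)]
    by (simp only: simp_thms)
qed

end
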